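(* Let $p$ be a prime and $r\ge 1$ an integer. Then, in $\overline{\mathbb{F}}_p[X,Y,Z]$, $$T_{p^r,1}(X,Y,Z)=\prod_{\substack{\alpha\in\mathbb{F}_{p^r}\\ \alpha\neq 0,1}}\bigl(Z-\alpha X+(\alpha-1)Y\bigr).$$
   Context: $\overline{\mathbb{F}}_p$ is an algebraic closure of $\mathbb{F}_p$ and $\mathbb{F}_{p^r}\subset\overline{\mathbb{F}}_p$ is its subfield with $p^r$ elements. For integers $A>B>0$ with $d=\gcd(A,B)$, $T_{A,B}(X,Y,Z)=\dfrac{R_{A,B}(X,Y,Z)}{V(X^d,Y^d,Z^d)}$, where $R_{A,B}(X,Y,Z)=\det\begin{pmatrix} X^{A} & Y^{A} & Z^{A}\\ X^{B} & Y^{B} & Z^{B}\\ 1&1&1\end{pmatrix}$ and $V(X,Y,Z)=(X-Y)(Z-X)(Z-Y)$; this quotient is a polynomial. An empty product is $1$. *)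

theory Defs
  imports "HOL-Analysis.Determinants" "HOL-Algebra.Algebraic_Closure_Type"
begin

section \<open>Finite subfields of a field\<close>

text \<open>
  When \<open>'k\<close> is an algebraic closure of a field with a prime number \<open>p\<close> of elements and \<open>r \<ge> 1\<close>,
  there is exactly one subfield of order \<open>p ^ r\<close>; see lemma \<open>ex1_subfield_of_order\<close> below.
\<close>

definition subfield_of_order :: "nat \<Rightarrow> 'k::field set" where
  "subfield_of_order q = (THE F. subfield F ring_of_type_algebra \<and> card F = q)"


section \<open>The polynomials of the statement\<close>

text \<open>
  The ring of polynomials over \<open>'k\<close> in \<open>X\<close>, \<open>Y\<close>, \<open>Z\<close> is the iterated polynomial ring
  \<open>'k[X][Y][Z]\<close>, that is, the type \<open>'k poly poly poly\<close>.
\<close>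

definition const3 :: "'k::comm_ring_1 \<Rightarrow> 'k poly poly poly" where
  "const3 c = [:[:[:c:]:]:]"

definition varX :: "'k::comm_ring_1 poly poly poly" where
  "varX = [:[:[:0, 1:]:]:]"

definition varY :: "'k::comm_ring_1 poly poly poly" where
  "varY = [:[:0, 1:]:]"

definition varZ :: "'k::comm_ring_1 poly poly poly" where
  "varZ = [:0, 1:]"

definition Rdet :: "nat \<Rightarrow> nat \<Rightarrow> 'a::comm_ring_1 \<Rightarrow> 'a \<Rightarrow> 'a \<Rightarrow> 'a" where
  "Rdet A B x y z =
     det (vector [vector [x ^ A, y ^ A, z ^ A],
                  vector [x ^ B, y ^ B, z ^ B],
                  vector [1, 1, 1]] :: 'a ^ 3 ^ 3)"

definition Vprod :: "'a::comm_ring_1 \<Rightarrow> 'a \<Rightarrow> 'a \<Rightarrow> 'a" where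
  "Vprod x y z = (x - y) * (z - x) * (z - y)"

text \<open>
  Here \<open>div\<close> is exact division in an integral domain; lemma \<open>Tpoly_mult\<close> below shows that
  the quotient exists.
\<close>

definition Tpoly :: "nat \<Rightarrow> nat \<Rightarrow> 'k::field poly poly poly" where
  "Tpoly A B =
     (let d = gcd A B
      in Rdet A B varX varY varZ div Vprod (varX ^ d) (varY ^ d) (varZ ^ d))"


section \<open>The quotient is a polynomial\<close>

lemma Rdet_expand:
  "Rdet A B x y z = (x ^ A - z ^ A) * (y ^ B - z ^ B) - (y ^ A - z ^ A) * (x ^ B - z ^ B)"
  unfolding Rdet_def by (simp add: det_3 vector_3 algebra_simps)

lemma Vprod_dvd_Rdet: "Vprod x y z dvd Rdet a b x y (z :: 'a::comm_ring_1)"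
proof -
  define S where "S n t = (\<Sum>i<n. z ^ (n - Suc i) * t ^ i)" for n :: nat and t
  have S: "t ^ n - z ^ n = (t - z) * S n t" for n t
    unfolding S_def by (rule power_diff_sumr2)
  have "x - y dvd S n x - S n y" for n
  proof -
    have "x - y dvd x ^ i - y ^ i" for i
      by (simp add: power_diff_sumr2)
    hence "x - y dvd (\<Sum>i<n. z ^ (n - Suc i) * (x ^ i - y ^ i))"
      by (intro dvd_sum dvd_mult)
    thus ?thesis
      by (simp add: S_def sum_subtractf right_diff_distrib)
  qed
  then obtain ka kb where ka: "S a x - S a y = (x - y) * ka" and kb: "S b x - S b y = (x - y) * kb"
    unfolding dvd_def by metis
  have ka': "S a x = S a y + (x - y) * ka" and kb': "S b x = S b y + (x - y) * kb"
    using ka kb by (simp_all add: algebra_simps)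
  have "Rdet a b x y z = (x - z) * (y - z) * (S a x * S b y - S a y * S b x)"
    unfolding Rdet_expand S by (simp add: algebra_simps)
  also have "S a x * S b y - S a y * S b x = (x - y) * (ka * S b y - kb * S a y)"
    unfolding ka' kb' by (simp add: algebra_simps)
  also have "(x - z) * (y - z) * ((x - y) * (ka * S b y - kb * S a y)) =
      Vprod x y z * (ka * S b y - kb * S a y)"
    unfolding Vprod_def by (simp add: algebra_simps)
  finally show ?thesis by simp
qed

lemma Tpoly_mult:
  "Tpoly A B * Vprod (varX ^ gcd A B) (varY ^ gcd A B) (varZ ^ gcd A B) = Rdet A B varX varY varZ"
proof -
  define d where "d = gcd A B"
  obtain a b where "A = d * a" "B = d * b"
    unfolding d_def by (metis dvd_def gcd_dvd1 gcd_dvd2)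
  hence "Rdet A B x y z = Rdet a b (x ^ d) (y ^ d) (z ^ d)" for x y z :: "'a poly poly poly"
    by (simp add: Rdet_def power_mult)
  hence "Vprod (varX ^ d) (varY ^ d) (varZ ^ d) dvd
      (Rdet A B varX varY varZ :: 'a poly poly poly)"
    by (simp only: Vprod_dvd_Rdet)
  thus ?thesis
    by (simp add: Tpoly_def Let_def d_def)
qed


section \<open>Existence and uniqueness of finite subfields\<close>

lemma subfield_ring_of_type_algebra_iff:
  "subfield F (ring_of_type_algebra :: 'k::field ring) \<longleftrightarrow>
     1 \<in> F \<and> (\<forall>x\<in>F. \<forall>y\<in>F. x - y \<in> F \<and> x * y \<in> F \<and> inverse x \<in> F)"
  (is "?lhs \<longleftrightarrow> ?rhs")
proof -
  let ?R = "ring_of_type_algebra :: 'k ring"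
  interpret R: field ?R by rule
  have [simp]: "carrier ?R = UNIV" "\<one>\<^bsub>?R\<^esub> = 1" "\<zero>\<^bsub>?R\<^esub> = 0"
      "x \<oplus>\<^bsub>?R\<^esub> y = x + y" "x \<otimes>\<^bsub>?R\<^esub> y = x * y" for x y
    by (simp_all add: ring_of_type_algebra_def)
  have [simp]: "\<ominus>\<^bsub>?R\<^esub> x = - x" for x
    using R.minus_equality[of "- x" x] by simp
  have inv: "inv\<^bsub>?R\<^esub> x = inverse x" if "x \<noteq> 0" for x
    using R.inv_char[of x "inverse x"] that by simp
  show ?thesis
  proof
    assume F: ?lhs
    note sr = subringE[OF subfieldE(1)[OF F]]
    have 1: "1 \<in> F" using sr(3) by simp
    have 2: "x - y \<in> F" if "x \<in> F" "y \<in> F" for x y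
      using sr(7)[OF that(1) sr(5)[OF that(2)]] by simp
    have 3: "x * y \<in> F" if "x \<in> F" "y \<in> F" for x y
      using sr(6)[OF that] by simp
    have 4: "inverse x \<in> F" if "x \<in> F" for x
      using R.subfield_m_inv(1)[OF F, of x] that inv[of x] by (cases "x = 0") auto
    show ?rhs using 1 2 3 4 by blast
  next
    assume F: ?rhs
    hence 0: "0 \<in> F" by (metis diff_self)
    have neg: "- x \<in> F" if "x \<in> F" for x using F 0 that by (metis diff_0)
    have add: "x + y \<in> F" if "x \<in> F" "y \<in> F" for x y
      using F neg that by (metis diff_minus_eq_add)
    show ?lhs
      by (rule R.subfieldI', rule R.subringI) (use F neg add inv in auto)
  qed
qed

lemma algebraically_closed_poly_root:
  fixes f :: "'k::field poly"
  assumes "algebraically_closed (ring_of_type_algebra :: 'k ring)" and deg: "Polynomial.degree f > 0"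
  shows "\<exists>x. poly f x = 0"
proof -
  let ?R = "ring_of_type_algebra :: 'k ring"
  interpret R: algebraically_closed ?R by fact
  have [simp]: "carrier ?R = UNIV" "\<one>\<^bsub>?R\<^esub> = 1" "\<zero>\<^bsub>?R\<^esub> = 0"
      "x \<oplus>\<^bsub>?R\<^esub> y = x + y" "x \<otimes>\<^bsub>?R\<^esub> y = x * y" for x y
    by (simp_all add: ring_of_type_algebra_def)
  have [simp]: "x [^]\<^bsub>?R\<^esub> n = x ^ n" for x :: 'k and n :: nat
    by (induction n) (auto simp: mult.commute)
  define P where "P = rev (Polynomial.coeffs f)"
  have degP: "Polynomials.degree P = Polynomial.degree f"
    by (auto simp: P_def degree_eq_length_coeffs)
  have P: "P \<in> carrier (poly_ring ?R)"
    using deg by (auto simp: univ_poly_def polynomial_def P_def hd_rev last_coeffs_eq_coeff_degree)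
  hence "R.splitted P" by (rule R.roots_over_carrier)
  hence "R.roots P \<noteq> {#}"
    unfolding R.splitted_def using degP deg by auto
  then obtain x where "x \<in># R.roots P" by blast
  hence "R.eval P x = 0"
    using R.roots_mem_iff_is_root[OF P] by (auto simp: R.is_root_def)
  moreover have "R.eval xs x = poly (Poly (rev xs)) x" for xs
    by (induction xs) (auto simp: Poly_append poly_monom)
  ultimately show ?thesis
    by (auto simp: P_def)
qed

lemma card_roots_eq_degree:
  fixes f :: "'k::field poly"
  assumes closed: "\<And>g :: 'k poly. Polynomial.degree g > 0 \<Longrightarrow> \<exists>x. poly g x = 0"
  assumes "f \<noteq> 0" and "\<And>x. poly f x = 0 \<Longrightarrow> poly (pderiv f) x \<noteq> 0"
  shows "card {x. poly f x = 0} = Polynomial.degree f"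
  using assms(2-)
proof (induction "Polynomial.degree f" arbitrary: f)
  case 0
  then obtain c where "f = [:c:]"
    using degree_eq_zeroE by metis
  moreover from this have "c \<noteq> 0"
    using 0 by auto
  ultimately show ?case by simp
next
  case (Suc n)
  obtain a where a: "poly f a = 0" using closed[of f] Suc by auto
  then obtain g where f: "f = [:- a, 1:] * g" by (auto simp: poly_eq_0_iff_dvd dvd_def)
  have g: "g \<noteq> 0" using Suc f by auto
  have deg: "Polynomial.degree f = Suc (Polynomial.degree g)"
    unfolding f using g by (subst degree_mult_eq) auto
  have pd: "poly (pderiv f) x = (x - a) * poly (pderiv g) x + poly g x" for x
    unfolding f pderiv_mult by (simp add: pderiv_pCons algebra_simps)
  have ga: "poly g a \<noteq> 0" using Suc.prems(2)[OF a] pd[of a] by simp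
  have "poly (pderiv g) x \<noteq> 0" if "poly g x = 0" for x
    using Suc.prems(2)[of x] that pd[of x] by (auto simp: f)
  hence card: "card {x. poly g x = 0} = Polynomial.degree g"
    using Suc.hyps deg g by auto
  have "{x. poly f x = 0} = insert a {x. poly g x = 0}"
    by (auto simp: f)
  moreover have "card (insert a {x. poly g x = 0}) = Suc (card {x. poly g x = 0})"
    by (rule card_insert_disjoint) (use poly_roots_finite[OF g] ga in auto)
  ultimately show ?case
    by (simp only: card deg)
qed

lemma CHAR_of_subfield_card:
  fixes P :: "'k::field set"
  assumes P: "subfield P (ring_of_type_algebra :: 'k ring)" and "card P = p" "Factorial_Ring.prime p"
  shows "CHAR('k) = p"
proof -
  have fin: "finite P" using assms by (metis card.infinite not_prime_0)
  have 1: "1 \<in> P" and diff: "\<And>x y. x \<in> P \<Longrightarrow> y \<in> P \<Longrightarrow> x - y \<in> P"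
    using P by (auto simp: subfield_ring_of_type_algebra_iff)
  have "x + 1 \<in> P" if "x \<in> P" for x
    using diff[OF that diff[OF diff[OF 1 1] 1]] by simp
  hence "bij_betw (\<lambda>x. x + 1) P P"
    by (intro bij_betwI[of _ _ _ "\<lambda>x. x - 1"]) (auto simp: diff 1)
  hence "(\<Sum>x\<in>P. x + 1) = (\<Sum>x\<in>P. x)"
    by (rule sum.reindex_bij_betw)
  hence "of_nat p = (0 :: 'k)" using assms by (simp add: sum.distrib)
  hence "CHAR('k) dvd p" by (simp add: of_nat_eq_0_iff_char_dvd)
  hence "CHAR('k) = 1 \<or> CHAR('k) = p" using assms(3) unfolding prime_nat_iff by metis
  thus ?thesis using CHAR_not_1'[where 'a = 'k] by simp
qed

lemma subfield_card_power_eq: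
  fixes F :: "'k::field set"
  assumes F: "subfield F (ring_of_type_algebra :: 'k ring)" and "card F = q" "q > 0" and x: "x \<in> F"
  shows "x ^ q = x"
proof (cases "x = 0")
  case False
  have fin: "finite F" using assms by (metis card.infinite less_irrefl)
  have F': "1 \<in> F" "\<And>x y. x \<in> F \<Longrightarrow> y \<in> F \<Longrightarrow> x * y \<in> F" "\<And>x. x \<in> F \<Longrightarrow> inverse x \<in> F"
      "\<And>x y. x \<in> F \<Longrightarrow> y \<in> F \<Longrightarrow> x - y \<in> F"
    using F by (auto simp: subfield_ring_of_type_algebra_iff)
  have 0: "0 \<in> F" using F'(4)[OF F'(1) F'(1)] by simp
  have "bij_betw (\<lambda>y. x * y) (F - {0}) (F - {0})"
    by (intro bij_betwI[of _ _ _ "\<lambda>y. inverse x * y"]) (auto simp: F' x False)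
  hence "(\<Prod>y\<in>F - {0}. x * y) = (\<Prod>y\<in>F - {0}. y)"
    by (rule prod.reindex_bij_betw)
  moreover have "(\<Prod>y\<in>F - {0}. y) \<noteq> 0" using fin by simp
  ultimately have "x ^ (q - 1) = 1"
    using fin 0 assms by (simp add: prod.distrib)
  thus ?thesis using assms(3) by (metis mult.left_neutral power_minus_mult)
qed (use assms in auto)

lemma ex1_subfield_of_order:
  fixes P :: "'k::field set"
  assumes closure: "algebraic_closure (ring_of_type_algebra :: 'k ring) P"
    and P: "card P = p" and p: "Factorial_Ring.prime p" and r: "r \<ge> 1"
  shows "\<exists>!F :: 'k set. subfield F ring_of_type_algebra \<and> card F = p ^ r"
proof -
  let ?R = "ring_of_type_algebra :: 'k ring"
  interpret L: algebraic_closure ?R P by fact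
  have CHAR: "CHAR('k) = p"
    using CHAR_of_subfield_card[OF L.subfield_axioms] P p by blast
  define q where "q = p ^ r"
  have q: "q > 1" unfolding q_def using one_less_power[OF prime_gt_1_nat[OF p], of r] r by simp
  define K where "K = {x :: 'k. x ^ q = x}"
  have add: "(x + y) ^ q = x ^ q + y ^ q" for x y :: 'k
    using freshmans_dream'[of q r x y] CHAR p by (simp add: q_def)
  have "(x - y) ^ q = x ^ q - y ^ q" for x y :: 'k
    using add[of "x - y" y] by simp
  hence K: "subfield K ?R"
    using q by (auto simp: subfield_ring_of_type_algebra_iff K_def power_mult_distrib
          power_inverse)
  define f where "f = Polynomial.monom (1 :: 'k) q - [:0, 1:]"
  have "of_nat q = (0 :: 'k)"
    using r by (simp add: of_nat_eq_0_iff_char_dvd CHAR q_def)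
  hence "pderiv f = - 1"
    by (simp add: f_def pderiv_diff pderiv_monom pderiv_pCons one_pCons)
  moreover have deg: "Polynomial.degree f = q"
    unfolding f_def diff_conv_add_uminus
    by (subst degree_add_eq_left) (use q in \<open>auto simp: Polynomial.degree_monom_eq\<close>)
  moreover have "f \<noteq> 0" using deg q by auto
  ultimately have "card {x. poly f x = 0} = q"
    using card_roots_eq_degree[of f] algebraically_closed_poly_root[OF L.algebraically_closed_axioms]
    by auto
  moreover have "{x. poly f x = 0} = K"
    by (auto simp: f_def K_def poly_monom)
  ultimately have card: "card K = q" by simp
  have fin: "finite K" using card q by (metis card.infinite not_one_less_zero)
  have "F = K" if "subfield F ?R" "card F = q" for F
  proof -
    have "F \<subseteq> K" using subfield_card_power_eq[OF that] q by (auto simp: K_def)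
    thus ?thesis using card_subset_eq[OF fin] card that by simp
  qed
  with K card show ?thesis unfolding q_def by blast
qed

end

theory Submission
  imports Defs
begin

text \<open>
  Put \<open>q = p ^ r\<close>, \<open>a = Z - Y\<close> and \<open>b = X - Y\<close>. By additivity of the Frobenius map, the determinant
  is invariant under the translation by \<open>Y\<close>, hence equals \<open>b * a ^ q - a * b ^ q\<close>. The elements
  of the field \<open>F\<close> with \<open>q\<close> elements are the roots of \<open>T ^ q - T\<close>, so this form factors as the
  product of \<open>b\<close> and all \<open>a - \<alpha> * b\<close> with \<open>\<alpha> \<in> F\<close>. The factors \<open>b\<close>, \<open>\<alpha> = 0\<close> and \<open>\<alpha> = 1\<close> make up
  \<open>V\<close>, and the other ones are those of the claim.
\<close>

text \<open>For nonzero \<open>b\<close>, both sides are polynomials in \<open>a\<close> of degree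
  at most \<open>q\<close> with the same coefficient of \<open>a ^ q\<close>, and both vanish at the
  \<open>q\<close> points \<open>s * b\<close>, so they coincide.\<close>

lemma prod_diff_mult_eq_if_power_eq_self:
  fixes a b :: "'a::idom"
  assumes card: "card S = q" and q: "q > 1" and S: "\<And>s. s \<in> S \<Longrightarrow> s ^ q = s"
  shows "b * (\<Prod>s\<in>S. a - s * b) = b * a ^ q - a * b ^ q"
proof (cases "b = 0")
  case False
  \<comment> \<open>\<open>f\<close> and \<open>g\<close> are the two sides with \<open>a\<close>
    replaced by an indeterminate.\<close>
  define f where "f = Polynomial.smult b (\<Prod>s\<in>S. [:- (s * b), 1:])"
  define g where "g = Polynomial.monom b q - [:0, b ^ q:]"
  have fin: "finite S"
    using card q by (metis card.infinite not_one_less_zero)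
  have prod: "Polynomial.degree (\<Prod>s\<in>S. [:- (s * b), 1:]) = q"
    by (subst degree_prod_eq_sum_degree) (simp_all add: card)
  have lead: "Polynomial.lead_coeff (\<Prod>s\<in>S. [:- (s * b), 1:]) = 1"
    by (simp add: lead_coeff_prod)
  have "f = g"
  proof (rule poly_eqI_degree_lead_coeff[where n = q and A = "(\<lambda>s. s * b) ` S"])
    show "poly f x = poly g x" if x: "x \<in> (\<lambda>s. s * b) ` S" for x
    proof -
      obtain s where s: "s \<in> S" "x = s * b" using x by blast
      have "(\<Prod>t\<in>S. x - t * b) = 0"
        using fin s by (auto simp: prod_zero_iff)
      moreover have "b * x ^ q = x * b ^ q"
        using S[OF s(1)] by (simp add: s(2) power_mult_distrib)
      ultimately show ?thesis
        by (simp add: f_def g_def poly_prod poly_monom)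
    qed
    \<comment> \<open>The points \<open>s * b\<close> are distinct because \<open>b\<close> is
      nonzero in this case.\<close>
    show "card ((\<lambda>s. s * b) ` S) \<ge> q"
      by (subst card_image) (use False card in \<open>auto simp: inj_on_def\<close>)
    show "Polynomial.degree f \<le> q"
      using prod by (simp add: f_def)
    show "Polynomial.degree g \<le> q"
      unfolding g_def using q by (intro degree_diff_le degree_monom_le) simp
    show "Polynomial.coeff f q = Polynomial.coeff g q"
      using lead prod q by (simp add: f_def g_def coeff_pCons split: nat.splits)
  qed
  hence "poly f a = poly g a" by simp
  thus ?thesis
    by (simp add: f_def g_def poly_prod poly_monom)
qed (use q in simp)

text \<open>Raising to the power \<open>q\<close> is an iterate of Frobenius, so
  \<open>(u - v) ^ q\<close> splits and both sides expand to the same terms.\<close>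

lemma Rdet_CHAR_power_1:
  fixes x y z :: "'a::comm_ring_1"
  assumes "Factorial_Ring.prime CHAR('a)" and q: "q = CHAR('a) ^ r"
  shows "Rdet q 1 x y z = (x - y) * (z - y) ^ q - (z - y) * (x - y) ^ q"
proof -
  have add: "(u + v) ^ q = u ^ q + v ^ q" for u v :: 'a
    using freshmans_dream'[OF assms] by simp
  have diff: "(u - v) ^ q = u ^ q - v ^ q" for u v :: 'a
    using add[of "u - v" v] by simp
  show ?thesis
    unfolding Rdet_expand diff by (simp add: algebra_simps)
qed

theorem mainTheorem5:
  fixes p r :: nat and Fp :: "'k::field set"
  assumes "Factorial_Ring.prime p" and "r \<ge> 1"
    and "algebraic_closure (ring_of_type_algebra :: 'k ring) Fp" and "card Fp = p"
  shows "(Tpoly (p ^ r) 1 :: 'k poly poly poly) =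
    (\<Prod>\<alpha>\<in>subfield_of_order (p ^ r) - {0, 1}.
       varZ - const3 \<alpha> * varX + const3 (\<alpha> - 1) * varY)"
proof -
  interpret L: algebraic_closure "ring_of_type_algebra :: 'k ring" Fp by fact
  define q where "q = p ^ r"
  define F :: "'k set" where "F = subfield_of_order q"
  define a b :: "'k poly poly poly" where "a = varZ - varY" and "b = varX - varY"
  define P where "P = (\<Prod>\<alpha>\<in>F - {0, 1}. varZ - const3 \<alpha> * varX + const3 (\<alpha> - 1) * varY)"
  have CHAR: "CHAR('k) = p"
    using CHAR_of_subfield_card[OF L.subfield_axioms] assms by blast
  have q: "q > 1"
    unfolding q_def using one_less_power[OF prime_gt_1_nat] assms by simp
  have F: "subfield F ring_of_type_algebra" "card F = q"
    using theI'[OF ex1_subfield_of_order[OF assms(3,4,1,2)]]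
    by (simp_all add: F_def subfield_of_order_def q_def)
  have fin: "finite F"
    using F(2) q by (metis card.infinite not_one_less_zero)
  have 1: "1 \<in> F" and 0: "0 \<in> F"
    using F(1) by (auto simp: subfield_ring_of_type_algebra_iff) (metis diff_self)
  have inj: "inj_on const3 F"
    by (auto simp: inj_on_def const3_def)
  have power: "const3 \<alpha> ^ n = const3 (\<alpha> ^ n)" for \<alpha> :: 'k and n
    by (simp add: const3_def poly_const_pow)
  \<comment> \<open>This allows cancelling \<open>V\<close> from the final equation in an integral
    domain.\<close>
  have nz: "Vprod varX varY varZ \<noteq> (0 :: 'k poly poly poly)"
    by (simp add: Vprod_def varX_def varY_def varZ_def)
  have factor: "a - const3 \<alpha> * b = varZ - const3 \<alpha> * varX + const3 (\<alpha> - 1) * varY" for \<alpha>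
  proof -
    have const: "const3 (\<alpha> - 1) = const3 \<alpha> - 1"
      by (simp add: const3_def one_pCons)
    show ?thesis
      unfolding a_def b_def const by (simp add: algebra_simps)
  qed
  have "Tpoly q 1 * Vprod varX varY varZ = (Rdet q 1 varX varY varZ :: 'k poly poly poly)"
    using Tpoly_mult[of q 1] by simp
  also have "\<dots> = b * a ^ q - a * b ^ q"
    unfolding a_def b_def
    by (rule Rdet_CHAR_power_1[of q r]) (use assms CHAR in \<open>simp_all add: q_def\<close>)
  \<comment> \<open>The roots must lie in the same domain as \<open>a\<close> and \<open>b\<close>,
    so \<open>F\<close> enters as constant polynomials; by \<open>inj\<close> there are still
    \<open>q\<close> of them.\<close>
  also have "\<dots> = b * (\<Prod>s\<in>const3 ` F. a - s * b)"
    by (rule prod_diff_mult_eq_if_power_eq_self[symmetric])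
      (use F q subfield_card_power_eq[OF F] in \<open>auto simp: card_image inj power\<close>)
  also have "(\<Prod>s\<in>const3 ` F. a - s * b) = (\<Prod>\<alpha>\<in>F. a - const3 \<alpha> * b)"
    by (simp add: prod.reindex inj)
  also have "\<dots> = (a - const3 0 * b) * ((a - const3 1 * b) * (\<Prod>\<alpha>\<in>F - {0} - {1}. a - const3 \<alpha> * b))"
    using fin 0 1 by (simp add: prod.remove[of F 0] prod.remove[of "F - {0}" 1])
  also have "F - {0} - {1} = F - {0, 1}" by blast
  also have "(\<Prod>\<alpha>\<in>F - {0, 1}. a - const3 \<alpha> * b) = P"
    by (simp add: P_def factor)
  \<comment> \<open>The three split-off factors are \<open>X - Y\<close>, \<open>Z - Y\<close> and
    \<open>Z - X\<close>.\<close>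
  also have "b * ((a - const3 0 * b) * ((a - const3 1 * b) * P)) = P * Vprod varX varY varZ"
  proof -
    have "const3 0 = (0 :: 'k poly poly poly)" "const3 1 = (1 :: 'k poly poly poly)"
      by (simp_all add: const3_def one_pCons)
    thus ?thesis by (simp add: a_def b_def Vprod_def algebra_simps)
  qed
  finally show ?thesis
    using nz by (simp add: P_def F_def q_def)
qed

end
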